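(* Let $\mathcal F$ be a countably union-closed family of sets. If $(\mathcal F, \subseteq)$ satisfies the descending chain condition, then $(\mathscr N(\mathcal F), \subseteq)$ satisfies the ascending chain condition. Consequently, if $(\mathcal F, \subseteq)$ satisfies the descending chain condition and $a \in U_{\mathcal F}$, then there exists an element $b \in U_{\mathcal F}$ that is optimal in $\mathcal F$ and such that $\mathcal F_a \subseteq \mathcal F_b$.
   Context: A family of sets $\mathcal F$ is a subset of some power set (it may be infinite). Its universe is $U_{\mathcal F} := \bigcup_{A \in \mathcal F} A$. For $x \in U_{\mathcal F}$, $\mathcal F_x := \{A \in \mathcal F : x \in A\}$, and $\mathscr N(\mathcal F) := \{\mathcal F_x : x \in U_{\mathcal F}\}$, ordered by inclusion. A family is countably union-closed if it is closed under countable unions of members of the family (unions of nonempty countable collections of members). An element $x \in U_{\mathcal F}$ is optimal in $\mathcal F$ if $\mathcal F_x$ is a maximal element of $(\mathscr N(\mathcal F), \subseteq)$. A poset satisfies the descending chain condition (resp. ascending chain condition) if every nonempty subset of it has a minimal (resp. maximal) element. *)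

theory Defs
  imports "HOL-Library.Countable_Set"
begin

text \<open>
  A subset \<open>P\<close> of an ordered type is regarded as a poset under the induced order. For sets of sets
  and for sets of families, \<open>\<le>\<close> is inclusion.
\<close>

definition minimal_in :: "'b::order set \<Rightarrow> 'b \<Rightarrow> bool" where
  "minimal_in P m \<longleftrightarrow> m \<in> P \<and> (\<forall>y\<in>P. y \<le> m \<longrightarrow> y = m)"

definition maximal_in :: "'b::order set \<Rightarrow> 'b \<Rightarrow> bool" where
  "maximal_in P m \<longleftrightarrow> m \<in> P \<and> (\<forall>y\<in>P. m \<le> y \<longrightarrow> y = m)"

definition descending_chain_condition :: "'b::order set \<Rightarrow> bool" where
  "descending_chain_condition P \<longleftrightarrow> (\<forall>S. S \<subseteq> P \<and> S \<noteq> {} \<longrightarrow> (\<exists>m. minimal_in S m))"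

definition ascending_chain_condition :: "'b::order set \<Rightarrow> bool" where
  "ascending_chain_condition P \<longleftrightarrow> (\<forall>S. S \<subseteq> P \<and> S \<noteq> {} \<longrightarrow> (\<exists>m. maximal_in S m))"

definition universe :: "'a set set \<Rightarrow> 'a set" where
  "universe F = \<Union>F"

definition members_at :: "'a set set \<Rightarrow> 'a \<Rightarrow> 'a set set" where
  "members_at F x = {A \<in> F. x \<in> A}"

definition members_at_family :: "'a set set \<Rightarrow> 'a set set set" where
  "members_at_family F = {members_at F x | x. x \<in> universe F}"

text \<open>
  Only nonempty countable subfamilies are considered, so \<open>{}\<close> need not belong to \<open>F\<close>;
  \<open>countable\<close> includes the finite case.
\<close>

definition countably_union_closed :: "'a set set \<Rightarrow> bool" where
  "countably_union_closed F \<longleftrightarrow> (\<forall>C. C \<subseteq> F \<and> C \<noteq> {} \<and> countable C \<longrightarrow> \<Union>C \<in> F)"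

definition optimal_in :: "'a set set \<Rightarrow> 'a \<Rightarrow> bool" where
  "optimal_in F x \<longleftrightarrow> x \<in> universe F \<and> maximal_in (members_at_family F) (members_at F x)"

end

theory Submission
  imports Defs
begin

text \<open>
  If the ascending chain condition fails for the families \<open>members_at F x\<close>, dependent choice gives
  points \<open>x 0, x 1, \<dots>\<close> whose families \<open>members_at F (x n)\<close> strictly increase. A set \<open>A n\<close> in the
  \<open>Suc n\<close>-th family but not in the \<open>n\<close>-th one contains every later point and, because the families
  increase, none of \<open>x 0, \<dots>, x n\<close>. The tails \<open>\<Union>k\<ge>n. A k\<close> are countable unions, hence belong to
  \<open>F\<close>. They decrease, and they do so strictly, as \<open>x (Suc n)\<close> lies in the \<open>n\<close>-th tail but not in the
  next one. This contradicts the descending chain condition on \<open>F\<close>, which proves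
  \<open>acc_members_at_family\<close>.

  An optimal point above \<open>a\<close> then comes from a maximal element among the families that contain
  \<open>members_at F a\<close>: these form an upward closed set, so being maximal in it means being maximal
  overall (\<open>maximal_above_if_acc\<close>).
\<close>

lemma no_strictly_decreasing_sequence:
  fixes f :: "nat \<Rightarrow> 'b::order"
  assumes "descending_chain_condition P" and "range f \<subseteq> P" and dec: "\<And>n. f (Suc n) < f n"
  shows False
proof -
  obtain m where "minimal_in (range f) m"
    using assms(1,2) unfolding descending_chain_condition_def by blast
  then obtain n where "minimal_in (range f) (f n)"
    unfolding minimal_in_def by blast
  then have "f (Suc n) = f n"
    using dec[of n] unfolding minimal_in_def by (simp add: less_imp_le)
  then show False
    using dec[of n] by simp
qed

lemma strictly_increasing_sequence_if_not_acc:
  fixes P :: "'b::order set"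
  assumes "\<not> ascending_chain_condition P"
  obtains f :: "nat \<Rightarrow> 'b" where "range f \<subseteq> P" and "\<And>n. f n < f (Suc n)"
proof -
  obtain S where S: "S \<subseteq> P" "S \<noteq> {}" and no_max: "\<And>m. \<not> maximal_in S m"
    using assms unfolding ascending_chain_condition_def by blast
  have step: "\<exists>t. t \<in> S \<and> s < t" if "s \<in> S" for s
    using no_max[of s] that unfolding maximal_in_def by (metis order.not_eq_order_implies_strict)
  have "\<exists>f. \<forall>n. f n \<in> S \<and> f n < f (Suc n)"
    by (rule dependent_nat_choice) (use S step in auto)
  then show thesis
    using S that by blast
qed

lemma acc_members_at_family:
  assumes closed: "countably_union_closed F" and dcc: "descending_chain_condition F"
  shows "ascending_chain_condition (members_at_family F)"
proof (rule ccontr)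
  assume "\<not> ascending_chain_condition (members_at_family F)"
  then obtain f where f: "range f \<subseteq> members_at_family F" and inc: "\<And>n. f n < f (Suc n)"
    by (rule strictly_increasing_sequence_if_not_acc) blast
  have "\<exists>x. f n = members_at F x" for n
    using f unfolding members_at_family_def by blast
  then obtain x where x: "\<And>n. f n = members_at F (x n)"
    by metis
  have "\<exists>A. A \<in> f (Suc n) - f n" for n
    using inc[of n] by blast
  then obtain A where A: "\<And>n. A n \<in> f (Suc n) - f n"
    by metis
  have mono: "f m \<subseteq> f n" if "m \<le> n" for m n
    using lift_Suc_mono_le[of f m n] inc that by (simp add: less_imp_le)
  \<comment> \<open>Since \<open>A n\<close> lies in \<open>F\<close>, lying outside \<open>members_at F (x n)\<close> can only mean \<open>x n \<notin> A n\<close>;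
    \<open>mono\<close> transfers this to the points before \<open>x n\<close>.\<close>
  have AF: "A n \<in> F" and later: "x (Suc n) \<in> A n" for n
    using A[of n] unfolding x members_at_def by auto
  have earlier: "x m \<notin> A n" if "m \<le> n" for m n
    using A[of n] AF[of n] mono[OF that] unfolding x members_at_def by blast
  \<comment> \<open>The sets \<open>A n\<close> themselves need not decrease; their tail unions do.\<close>
  define B where "B n = \<Union>(A ` {n..})" for n
  have "B n \<in> F" for n
  proof -
    have "A ` {n..} \<subseteq> F \<and> A ` {n..} \<noteq> {} \<and> countable (A ` {n..})"
      using AF by auto
    then show ?thesis
      using closed unfolding countably_union_closed_def B_def by blast
  qed
  then have "range B \<subseteq> F"
    by blast
  moreover have "B (Suc n) < B n" for n
  proof
    show "B (Suc n) \<subseteq> B n"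
      unfolding B_def by force
    have "x (Suc n) \<in> B n"
      using later unfolding B_def by auto
    moreover have "x (Suc n) \<notin> B (Suc n)"
      using earlier unfolding B_def by auto
    ultimately show "B (Suc n) \<noteq> B n"
      by blast
  qed
  ultimately show False
    using no_strictly_decreasing_sequence dcc by blast
qed

lemma maximal_above_if_acc:
  fixes p :: "'b::order"
  assumes "ascending_chain_condition P" and "p \<in> P"
  obtains m where "maximal_in P m" and "p \<le> m"
proof -
  let ?S = "{q \<in> P. p \<le> q}"
  obtain m where "maximal_in ?S m"
    using assms unfolding ascending_chain_condition_def
    by (metis (no_types, lifting) empty_iff mem_Collect_eq order_refl subsetI)
  then have "m \<in> P" "p \<le> m" and max: "\<And>q. q \<in> P \<Longrightarrow> p \<le> q \<Longrightarrow> m \<le> q \<Longrightarrow> q = m"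
    unfolding maximal_in_def by simp_all
  moreover from \<open>p \<le> m\<close> have "q = m" if "q \<in> P" "m \<le> q" for q
    using max[OF that(1) _ that(2)] order_trans[OF _ that(2)] by simp
  ultimately have "maximal_in P m \<and> p \<le> m"
    unfolding maximal_in_def by simp
  then show thesis
    using that by blast
qed

theorem lemma3p3:
  fixes F :: "'a set set"
  assumes "countably_union_closed F"
  shows "(descending_chain_condition F \<longrightarrow> ascending_chain_condition (members_at_family F)) \<and>
         (\<forall>a. descending_chain_condition F \<and> a \<in> universe F \<longrightarrow>
            (\<exists>b \<in> universe F. optimal_in F b \<and> members_at F a \<subseteq> members_at F b))"
proof (intro conjI allI impI)
  assume "descending_chain_condition F"
  then show "ascending_chain_condition (members_at_family F)"
    by (rule acc_members_at_family[OF assms])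
next
  fix a
  assume a: "descending_chain_condition F \<and> a \<in> universe F"
  then have "ascending_chain_condition (members_at_family F)"
    using assms acc_members_at_family by blast
  moreover have "members_at F a \<in> members_at_family F"
    using a unfolding members_at_family_def by blast
  ultimately obtain M where M: "maximal_in (members_at_family F) M" "members_at F a \<subseteq> M"
    by (rule maximal_above_if_acc)
  then obtain b where "b \<in> universe F" "M = members_at F b"
    unfolding maximal_in_def members_at_family_def by blast
  then show "\<exists>b \<in> universe F. optimal_in F b \<and> members_at F a \<subseteq> members_at F b"
    using M unfolding optimal_in_def by blast
qed

end
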